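(* Let $P\subset\mathbb{R}^d$ be a set of $n$ points, $\gamma\in(0,1)$, $0<\epsilon,\delta,\mu<1$, $h\in\mathbb{Z}^+$, and let $\varepsilon'$ be the accuracy parameter used in the approximate minimum enclosing ball computations. Then the tree construction for minimum enclosing ball with outliers described in the context, run with these inputs, has total time complexity $$T=O\left(\sum_{i=1}^{h}\left(\left(1+\frac1\delta\right)\ln\frac h\mu\right)^{i-1}\left(n+\frac{i}{\varepsilon'^2}\right)d\right).$$ If $1/\varepsilon'$ is assumed to be a constant, then $T=O(Cnd)$, which is linear in $n$ and $d$, where the hidden constant is $C=\left(\left(1+\frac1\delta\right)\ln\frac h\mu\right)^{h-1}$. Moreover, the queue used in the implementation always has size at most $C$ and takes space $O(Ch)$, and the total space complexity, including the input data, is $O(Ch+nd)$.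
   Context: For a finite set $Q\subset\mathbb{R}^d$, $MEB(Q)$ is the Euclidean ball of smallest radius covering $Q$. Approximate MEB center of accuracy $\varepsilon'$ of a finite set $Q\subset\mathbb{R}^d$: start with an arbitrary $c_1\in Q$; for $t=1,2,\dots,N-1$ with $N=1/\varepsilon'^2$, find the point $q\in Q$ farthest from $c_t$ and set $c_{t+1}=c_t+\frac{1}{t+1}(q-c_t)$; return $c_N$. Tree construction (input: $P$, $\gamma$, $\epsilon,\delta,\mu$, $h$). Each node of the tree is associated with a point of $P$ (node and point are denoted by the same symbol). The root $r$ is a randomly picked point of $P$ and has height $1$; a child of a node of height $i$ has height $i+1$. For a node $v$, let $\mathcal{P}^r_v$ be the set of points along the path from the root $r$ to $v$, and let $c_v$ be the center of $MEB(\mathcal{P}^r_v)$, where, to avoid the cost of an exact computation, the approximate MEB center of accuracy $\varepsilon'$ of $\mathcal{P}^r_v$ is used. Nodes of height $h$ are leaves. Every node $v$ of height less than $h$ is grown as follows: let $k=(1+\delta)\gamma n$ and let $P_v\subset P$ consist of the $k$ points of $P$ with the largest distances to $c_v$ (found with a linear-time selection algorithm); take a random sample $S_v$ of size $(1+\frac1\delta)\ln\frac h\mu$ from $P_v$, and make each sampled point a child of $v$. Implementation: the nodes are stored in a queue; when the head $v$ of the queue is popped, its $|S_v|$ children are pushed into the queue (breadth-first search on the tree). Each node $v$ in the queue stores only pointers to the points of $\mathcal{P}^r_v$. *)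

theory Defs
  imports "HOL-Probability.Probability_Mass_Function" "HOL-Library.Extended_Real"
begin

text \<open>
  The tree construction is written as a probabilistic program that carries a resource meter.
  The cost model is the usual real RAM: one unit of time for every arithmetic operation on reals
  (including square root), every comparison, every word read or written, and every random draw of
  a list element. Space is counted in words, a word holding one real number, one index or one
  pointer. A point of \<open>\<real>\<^sup>d\<close> is the list of its \<open>d\<close> coordinates (so that \<open>d\<close> is a number over which
  the hidden constants are uniform); the input \<open>P\<close> is an array of \<open>n\<close> distinct points, and a
  pointer to a point is an index into this array.
\<close>

record meter =
  time :: nat
  used :: nat
  peak :: nat

definition tick :: "nat \<Rightarrow> meter \<Rightarrow> meter" where
  "tick t m = m\<lparr>time := time m + t\<rparr>"

text \<open>Allocate and write \<open>w\<close> words.\<close>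
definition store :: "nat \<Rightarrow> meter \<Rightarrow> meter" where
  "store w m = m\<lparr>time := time m + w, used := used m + w, peak := max (peak m) (used m + w)\<rparr>"

definition free :: "nat \<Rightarrow> meter \<Rightarrow> meter" where
  "free w m = m\<lparr>used := used m - w\<rparr>"

text \<open>Execute a subroutine that takes time \<open>t\<close> and needs \<open>w\<close> words of scratch memory.\<close>
definition call :: "nat \<Rightarrow> nat \<Rightarrow> meter \<Rightarrow> meter" where
  "call t w m = m\<lparr>time := time m + t, peak := max (peak m) (used m + w)\<rparr>"


subsection \<open>Approximate center of the minimum enclosing ball\<close>

fun sq_sum :: "real list \<Rightarrow> real list \<Rightarrow> real \<Rightarrow> meter \<Rightarrow> real \<times> meter" where
  "sq_sum (x # xs) (y # ys) a m = sq_sum xs ys (a + (x - y) * (x - y)) (tick 5 m)"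
| "sq_sum _ _ a m = (a, m)"

definition distance :: "real list \<Rightarrow> real list \<Rightarrow> meter \<Rightarrow> real \<times> meter" where
  "distance p c m = (let (a, m) = sq_sum p c 0 m in (sqrt a, tick 1 m))"

text \<open>Scan of a list of pointers; the pair \<open>(q, r)\<close> is the farthest point so far with its distance.\<close>
fun farthest_from ::
  "real list list \<Rightarrow> real list \<Rightarrow> nat list \<Rightarrow> nat \<times> real \<Rightarrow> meter \<Rightarrow> nat \<times> meter" where
  "farthest_from P c [] (q, r) m = (q, m)"
| "farthest_from P c (i # Q) (q, r) m =
     (let (r', m) = distance (P ! i) c m
      in farthest_from P c Q (if r' > r then (i, r') else (q, r)) (tick 2 m))"

definition farthest :: "real list list \<Rightarrow> real list \<Rightarrow> nat list \<Rightarrow> meter \<Rightarrow> nat \<times> meter" where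
  "farthest P c Q m =
     (let (r, m) = distance (P ! hd Q) c (tick 1 m) in farthest_from P c (tl Q) (hd Q, r) m)"

text \<open>The update \<open>c + a (q - c)\<close>, in place.\<close>
fun move :: "real \<Rightarrow> real list \<Rightarrow> real list \<Rightarrow> meter \<Rightarrow> real list \<times> meter" where
  "move a (x # xs) (y # ys) m =
     (let (zs, m) = move a xs ys (tick 6 m) in ((x + a * (y - x)) # zs, m))"
| "move a _ _ m = ([], m)"

text \<open>\<open>refine P Q j t c m\<close> performs \<open>j\<close> iterations, with counter \<open>t, t + 1, \<dots>\<close>, starting from \<open>c\<close>.\<close>
fun refine ::
  "real list list \<Rightarrow> nat list \<Rightarrow> nat \<Rightarrow> nat \<Rightarrow> real list \<Rightarrow> meter \<Rightarrow> real list \<times> meter" where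
  "refine P Q 0 t c m = (c, m)"
| "refine P Q (Suc j) t c m =
     (let (q, m) = farthest P c Q m;
          (c, m) = move (1 / (real t + 1)) c (P ! q) (tick 2 m)
      in refine P Q j (Suc t) c m)"

text \<open>
  \<open>Q\<close> is the list of pointers to the covered points, \<open>pick\<close> the arbitrary choice of \<open>c\<^sub>1 \<in> Q\<close>,
  and the number of rounds is \<open>N = 1/\<epsilon>'\<^sup>2\<close>, rounded up.
\<close>
definition approx_center ::
  "(nat list \<Rightarrow> nat) \<Rightarrow> real list list \<Rightarrow> real \<Rightarrow> nat list \<Rightarrow> meter \<Rightarrow> real list \<times> meter" where
  "approx_center pick P eps' Q m =
     (let c = P ! pick Q; N = nat \<lceil>1 / eps'\<^sup>2\<rceil>
      in refine P Q (N - 1) 1 c (store (length c) (tick (1 + length c) m)))"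


subsection \<open>Selection\<close>

text \<open>
  A selection routine returns, for a list \<open>D\<close> of keys and a number \<open>k\<close>, the positions of \<open>k\<close> largest
  keys (ties being broken in any way), together with its running time and its scratch space.
  It is linear-time, with constant \<open>L\<close>, if both are at most \<open>L\<close> times the number of keys.
\<close>
type_synonym selector = "nat \<Rightarrow> real list \<Rightarrow> nat list \<times> nat \<times> nat"

definition linear_time_selector :: "nat \<Rightarrow> selector \<Rightarrow> bool" where
  "linear_time_selector L sel \<longleftrightarrow>
     (\<forall>k D. 1 \<le> k \<and> k \<le> length D \<longrightarrow>
       (case sel k D of (F, t, w) \<Rightarrow>
          distinct F \<and> length F = k \<and> set F \<subseteq> {..<length D} \<and>
          (\<forall>i\<in>set F. \<forall>j\<in>{..<length D} - set F. D ! j \<le> D ! i) \<and>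
          t \<le> L * length D \<and> w \<le> L * length D))"

fun distances :: "real list \<Rightarrow> real list list \<Rightarrow> meter \<Rightarrow> real list \<times> meter" where
  "distances c [] m = ([], m)"
| "distances c (p # ps) m =
     (let (r, m) = distance p c m; (rs, m) = distances c ps (store 1 m) in (r # rs, m))"


subsection \<open>The tree construction\<close>

record input =
  points :: "real list list"  \<comment> \<open>\<open>P\<close>\<close>
  gam :: real
  eps :: real  \<comment> \<open>enters the construction only through the choice of \<open>\<epsilon>'\<close>\<close>
  del :: real
  mu :: real
  hgt :: nat  \<comment> \<open>\<open>h\<close>\<close>

text \<open>What the description of the algorithm leaves to the implementer.\<close>
record implementation =
  acc :: real  \<comment> \<open>the accuracy \<open>\<epsilon>'\<close> of the approximate centers\<close>
  start :: "nat list \<Rightarrow> nat"  \<comment> \<open>the arbitrary starting point of an approximate center\<close>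
  select :: selector
  ssize :: nat  \<comment> \<open>the sample size, an integral rounding of \<open>(1 + 1/\<delta>) ln (h/\<mu>)\<close>\<close>

definition sample_size :: "input \<Rightarrow> real" where
  "sample_size I = (1 + 1 / del I) * ln (real (hgt I) / mu I)"

text \<open>\<open>k = (1 + \<delta>) \<gamma> n\<close> need not be an integer and may exceed \<open>n\<close>.\<close>
definition num_far :: "input \<Rightarrow> nat" where
  "num_far I = min (length (points I))
     (nat \<lceil>(1 + del I) * gam I * real (length (points I))\<rceil>)"

definition valid_input :: "nat \<Rightarrow> nat \<Rightarrow> input \<Rightarrow> bool" where
  "valid_input d n I \<longleftrightarrow>
     1 \<le> d \<and> 1 \<le> n \<and>
     length (points I) = n \<and> distinct (points I) \<and> (\<forall>p\<in>set (points I). length p = d) \<and>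
     0 < gam I \<and> gam I < 1 \<and> 0 < eps I \<and> eps I < 1 \<and> 0 < del I \<and> del I < 1 \<and>
     0 < mu I \<and> mu I < 1 \<and> 1 \<le> hgt I"

definition valid_implementation :: "nat \<Rightarrow> input \<Rightarrow> implementation \<Rightarrow> bool" where
  "valid_implementation L I A \<longleftrightarrow>
     0 < acc A \<and> (\<forall>Q. Q \<noteq> [] \<longrightarrow> start A Q \<in> set Q) \<and> linear_time_selector L (select A) \<and>
     (ssize A = nat \<lfloor>sample_size I\<rfloor> \<or> ssize A = nat \<lceil>sample_size I\<rceil>)"

text \<open>
  A queue entry for a node \<open>v\<close> consists of the identifier of \<open>v\<close> (its position in the tree array),
  the height of \<open>v\<close>, and the pointers to the points of \<open>\<P>\<^sup>r\<^sub>v\<close>, without repetition since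
  \<open>\<P>\<^sup>r\<^sub>v\<close> is a set. One further word links the entry to its successor in the queue. The tree is
  output as an array holding, for every node, the identifier of its parent and its point; the root
  is its own parent. The meter also charges the memory for this array.
\<close>
type_synonym entry = "nat \<times> nat \<times> nat list"

fun entry_words :: "entry \<Rightarrow> nat" where
  "entry_words (v, i, Q) = length Q + 3"

definition queue_words :: "entry list \<Rightarrow> nat" where
  "queue_words q = sum_list (map entry_words q)"

record state =
  queue :: "entry list"
  tree :: "(nat \<times> nat) list"
  meter :: meter

text \<open>\<open>k\<close> independent uniform draws from the elements of a list.\<close>
fun draw :: "nat \<Rightarrow> nat list \<Rightarrow> meter \<Rightarrow> (nat list \<times> meter) pmf" where
  "draw 0 F m = return_pmf ([], m)"
| "draw (Suc k) F m = do {
     x \<leftarrow> pmf_of_set (set F);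
     (S, m) \<leftarrow> draw k F (store 1 (tick 2 m));
     return_pmf (x # S, m)
   }"

text \<open>
  Create the children of the node \<open>v\<close> of height \<open>i\<close> with path points \<open>Q\<close>. For each of them the
  list \<open>Q\<close> is searched for the new point and copied.
\<close>
fun push_children :: "nat \<Rightarrow> nat \<Rightarrow> nat list \<Rightarrow> nat list \<Rightarrow> state \<Rightarrow> state" where
  "push_children v i Q [] st = st"
| "push_children v i Q (x # S) st =
     (let e = (length (tree st), Suc i, List.insert x Q)
      in push_children v i Q S
          \<lparr>queue = queue st @ [e], tree = tree st @ [(v, x)],
           meter = store (entry_words e + 2) (tick (3 * length Q + 1) (meter st))\<rparr>)"

text \<open>Initially the memory holds the \<open>n d\<close> coordinates of the input points.\<close>
definition init :: "input \<Rightarrow> state pmf" where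
  "init I = do {
     r \<leftarrow> pmf_of_set {..<length (points I)};
     let e = (0, 1, [r]);
     let w = sum_list (map length (points I));
     return_pmf \<lparr>queue = [e], tree = [(0, r)],
       meter = store (entry_words e + 2) (tick 1 \<lparr>time = 0, used = w, peak = w\<rparr>)\<rparr>
   }"

text \<open>One iteration of the breadth-first search: pop a node and, unless it is a leaf, grow it.\<close>
definition step :: "input \<Rightarrow> implementation \<Rightarrow> state \<Rightarrow> state pmf" where
  "step I A st = (case queue st of
     [] \<Rightarrow> return_pmf st
   | (v, i, Q) # q \<Rightarrow>
       (let m = tick (entry_words (v, i, Q) + 1) (meter st) in
        if i < hgt I then do {
          let (c, m) = approx_center (start A) (points I) (acc A) Q m;
          let (D, m) = distances c (points I) m;
          let (F, t, w) = select A (num_far I) D;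
          let m = store (length F) (call t w m);
          (S, m) \<leftarrow> draw (ssize A) F m;
          let m = free (length c + length D + length F) m;
          let st' = push_children v i Q S \<lparr>queue = q, tree = tree st, meter = m\<rparr>;
          return_pmf (st'\<lparr>meter := free (length S + entry_words (v, i, Q)) (meter st')\<rparr>)
        } else
          return_pmf (st\<lparr>queue := q, meter := free (entry_words (v, i, Q)) m\<rparr>)))"

fun run :: "input \<Rightarrow> implementation \<Rightarrow> nat \<Rightarrow> state pmf" where
  "run I A 0 = init I"
| "run I A (Suc j) = bind_pmf (run I A j) (step I A)"

text \<open>All states the construction may be in, over all random outcomes and all iterations.\<close>
definition reachable :: "input \<Rightarrow> implementation \<Rightarrow> state set" where
  "reachable I A = (\<Union>j. set_pmf (run I A j))"

text \<open>
  Worst-case complexities over all random outcomes. Since every iteration takes at least one unit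
  of time, a finite running time entails that the queue always gets empty. Within an iteration the
  queue only grows once its head has been popped, so that its largest sizes are seen between
  iterations; the peak memory in contrast is recorded by the meter during the iterations.
\<close>
definition running_time :: "input \<Rightarrow> implementation \<Rightarrow> ereal" where
  "running_time I A = (SUP st\<in>reachable I A. ereal (real (time (meter st))))"

definition max_queue_size :: "input \<Rightarrow> implementation \<Rightarrow> ereal" where
  "max_queue_size I A = (SUP st\<in>reachable I A. ereal (real (length (queue st))))"

definition max_queue_space :: "input \<Rightarrow> implementation \<Rightarrow> ereal" where
  "max_queue_space I A = (SUP st\<in>reachable I A. ereal (real (queue_words (queue st))))"

definition total_space :: "input \<Rightarrow> implementation \<Rightarrow> ereal" where
  "total_space I A = (SUP st\<in>reachable I A. ereal (real (peak (meter st))))"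

text \<open>
  The number \<open>(1 + 1/\<delta>) ln (h/\<mu>)\<close> in the bounds. Only if the sample size has been obtained by
  rounding this number up to an integer is it replaced by that integer.
\<close>
definition branching :: "input \<Rightarrow> implementation \<Rightarrow> real" where
  "branching I A = max (sample_size I) (real (ssize A))"

definition tree_const :: "input \<Rightarrow> implementation \<Rightarrow> real" where
  "tree_const I A = branching I A ^ (hgt I - 1)"

end

theory Submission
  imports Defs
begin

text \<open>
  Potential method: a queued node of height \<open>i\<close> stands for the whole subtree that will be grown from
  it, so it is given the total weight \<open>\<Sum>j. s\<^sup>j f (i + j)\<close> of that subtree, where \<open>s\<close> is the sample
  size and \<open>f\<close> a weight depending on the height. Popping a node of height \<open>i\<close> and pushing its
  children lowers the total potential by exactly \<open>f i\<close>. Counting leaves, nodes and time units by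
  \<open>f\<close> bounds the queue, the tree array and the running time. A path repeats no point, hence its length
  is at most \<open>min i n\<close>, which makes the costs of copying paths \<open>O(n)\<close>. If \<open>h \<ge> 2\<close> then the branching
  factor is at least \<open>2 ln 2 > 4/3\<close>, so that geometric sums are dominated by their last term.
\<close>

subsection \<open>Costs of the subroutines\<close>

lemma tick_tick [simp]: "tick a (tick b m) = tick (a + b) m"
  by (simp add: tick_def)

lemma tick_0 [simp]: "tick 0 m = m"
  by (simp add: tick_def)

text \<open>Without a \<open>free\<close> in between, the last allocation decides the peak, so
  allocations merge. Together with \<open>tick_store\<close> this brings every subroutine cost into
  the normal form \<open>store w (tick t m)\<close>.\<close>

lemma store_store: "store a (store b m) = store (a + b) m"
  by (simp add: store_def max_def)

lemma tick_store: "tick a (store b m) = store b (tick a m)"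
  by (simp add: store_def tick_def)

lemma sq_sum_meter:
  "length p = length c \<Longrightarrow> snd (sq_sum p c a m) = tick (5 * length c) m"
  by (induction p c a m rule: sq_sum.induct) (auto simp: add_ac)

lemma distance_meter:
  "length p = length c \<Longrightarrow> snd (distance p c m) = tick (5 * length c + 1) m"
  using sq_sum_meter[of p c 0 m] by (auto simp: distance_def split: prod.splits)

lemma farthest_from_meter:
  assumes "\<forall>i\<in>set Q. length (P ! i) = length c"
  shows "fst (farthest_from P c Q (q, r) m) \<in> insert q (set Q) \<and>
    snd (farthest_from P c Q (q, r) m) = tick (length Q * (5 * length c + 3)) m"
  using assms
proof (induction Q arbitrary: q r m)
  case (Cons i Q)
  obtain r' m' where e: "distance (P ! i) c m = (r', m')"
    by (cases "distance (P ! i) c m")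
  have m': "tick 2 m' = tick (5 * length c + 3) m"
    using distance_meter[of "P ! i" c m] e Cons.prems by (simp add: numeral_3_eq_3)
  have "farthest_from P c (i # Q) (q, r) m =
      farthest_from P c Q (if r' > r then (i, r') else (q, r)) (tick (5 * length c + 3) m)"
    by (simp add: e m')
  moreover have "length Q * (5 * length c + 3) + (5 * length c + 3) = length (i # Q) * (5 * length c + 3)"
    by simp
  ultimately show ?case
    using Cons.IH[of i r' "tick (5 * length c + 3) m"] Cons.IH[of q r "tick (5 * length c + 3) m"]
      Cons.prems by (cases "r' > r") (auto simp only: tick_tick if_True if_False list.set insert_iff)
qed simp

text \<open>The head of \<open>Q\<close> costs one read and a distance, \<open>5 d + 2\<close>
  units, whereas every other element costs \<open>5 d + 3\<close> because of its comparison. This is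
  the origin of the \<open>- 1\<close>.\<close>

lemma farthest_meter:
  assumes "\<forall>i\<in>set Q. length (P ! i) = length c" "Q \<noteq> []"
  shows "fst (farthest P c Q m) \<in> set Q \<and>
    snd (farthest P c Q m) = tick (length Q * (5 * length c + 3) - 1) m"
proof -
  obtain i Q' where Q: "Q = i # Q'"
    using assms by (cases Q) auto
  obtain r m' where e: "distance (P ! i) c (tick 1 m) = (r, m')"
    by (cases "distance (P ! i) c (tick 1 m)")
  have "m' = tick (5 * length c + 2) m"
    using distance_meter[of "P ! i" c "tick 1 m"] e assms Q by simp
  then show ?thesis
    using farthest_from_meter[of Q' P c i r m'] assms e Q
    by (auto simp: farthest_def algebra_simps)
qed

lemma move_meter:
  "length c = length p \<Longrightarrow>
    length (fst (move a c p m)) = length p \<and> snd (move a c p m) = tick (6 * length p) m"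
proof (induction a c p m rule: move.induct)
  case (1 a x xs y ys m)
  then show ?case
    by (auto split: prod.splits simp: add_ac)
qed auto

lemma refine_meter:
  assumes "\<forall>i\<in>set Q. length (P ! i) = d" "Q \<noteq> []" "length c = d"
  shows "length (fst (refine P Q j t c m)) = d \<and>
    snd (refine P Q j t c m) = tick (j * (length Q * (5 * d + 3) + 6 * d + 1)) m"
  using assms(3)
proof (induction j arbitrary: t c m)
  case (Suc j)
  obtain q m1 where e1: "farthest P c Q m = (q, m1)"
    by (cases "farthest P c Q m")
  have q: "q \<in> set Q" "m1 = tick (length Q * (5 * d + 3) - 1) m"
    using farthest_meter[of Q P c m] assms Suc.prems e1 by auto
  obtain c' m2 where e2: "move (1 / (real t + 1)) c (P ! q) (tick 2 m1) = (c', m2)"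
    by (cases "move (1 / (real t + 1)) c (P ! q) (tick 2 m1)")
  have c': "length c' = d" "m2 = tick (6 * d) (tick 2 m1)"
    using move_meter[of c "P ! q" "1 / (real t + 1)" "tick 2 m1"] assms Suc.prems q e2 by auto
  \<comment> \<open>Ensures that the \<open>- 1\<close> coming from \<open>farthest_meter\<close> is
    a true subtraction, so that it cancels against the \<open>tick 2\<close> of the
    iteration.\<close>
  have "length Q * (5 * d + 3) > 0"
    using assms(2) by simp
  then have "m2 = tick (length Q * (5 * d + 3) + 6 * d + 1) m"
    unfolding c'(2) q(2) by (simp add: algebra_simps)
  then show ?case
    using Suc.IH[of c' "Suc t" m2] e1 e2 c' by (auto simp: add_ac)
qed simp

lemma approx_center_meter:
  assumes "\<forall>i\<in>set Q. length (P ! i) = d" "Q \<noteq> []" "pick Q \<in> set Q"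
  shows "length (fst (approx_center pick P e Q m)) = d \<and>
    snd (approx_center pick P e Q m) =
      store d (tick (1 + d + (nat \<lceil>1 / e\<^sup>2\<rceil> - 1) * (length Q * (5 * d + 3) + 6 * d + 1)) m)"
  using refine_meter[of Q P d "P ! pick Q"] assms
  by (simp add: approx_center_def Let_def tick_store add_ac)

text \<open>The empty list is a separate case because \<open>store 0\<close> is not the identity on
  arbitrary meters: it raises \<open>peak\<close> to at least \<open>used\<close>. The same
  distinction recurs for drawing and for pushing children.\<close>

lemma distances_meter:
  assumes "\<forall>p\<in>set ps. length p = length c"
  shows "length (fst (distances c ps m)) = length ps \<and>
    snd (distances c ps m) =
      (if ps = [] then m else store (length ps) (tick (length ps * (5 * length c + 1)) m))"
  using assms
proof (induction ps arbitrary: m)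
  case Nil
  then show ?case by simp
next
  case (Cons p ps)
  obtain r m1 where e1: "distance p c m = (r, m1)"
    by (cases "distance p c m")
  have m1: "m1 = tick (5 * length c + 1) m"
    using distance_meter[of p c m] e1 Cons.prems by simp
  obtain rs m2 where e2: "distances c ps (store 1 m1) = (rs, m2)"
    by (cases "distances c ps (store 1 m1)")
  show ?case
    using Cons.IH[of "store 1 m1"] Cons.prems e1 e2
    by (auto simp: m1 tick_store store_store add_ac)
qed

lemma draw_meter:
  assumes "(S, m') \<in> set_pmf (draw k F m)" "F \<noteq> []"
  shows "length S = k \<and> set S \<subseteq> set F \<and> m' = (if k = 0 then m else store k (tick (2 * k) m))"
  using assms(1)
proof (induction k arbitrary: S m m')
  case 0
  then show ?case by simp
next
  case (Suc k)
  obtain x S' where x: "x \<in> set F" "S = x # S'" "(S', m') \<in> set_pmf (draw k F (store 1 (tick 2 m)))"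
    using Suc.prems assms(2) by (auto simp: set_pmf_of_set)
  show ?case
    using Suc.IH[OF x(3)] x by (auto simp: tick_store store_store numeral_2_eq_2)
qed

text \<open>The identifiers of the new entries stay existential, since no cost depends on them. The
  \<open>2 * length S\<close> words are the slots of the tree array.\<close>

lemma push_children_meter:
  "\<exists>es. queue (push_children v i Q S st) = queue st @ es \<and> length es = length S \<and>
     (\<forall>e\<in>set es. \<exists>v' x. x \<in> set S \<and> e = (v', Suc i, List.insert x Q)) \<and>
     length (tree (push_children v i Q S st)) = length (tree st) + length S \<and>
     meter (push_children v i Q S st) =
       (if S = [] then meter st
        else store (queue_words es + 2 * length S) (tick (length S * (3 * length Q + 1)) (meter st)))"
proof (induction S arbitrary: st)
  case Nil
  then show ?case by simp
next
  case (Cons x S)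
  define e where "e = (length (tree st), Suc i, List.insert x Q)"
  define st1 where "st1 = \<lparr>queue = queue st @ [e], tree = tree st @ [(v, x)],
      meter = store (entry_words e + 2) (tick (3 * length Q + 1) (meter st))\<rparr>"
  have st: "push_children v i Q (x # S) st = push_children v i Q S st1"
    by (simp add: st1_def e_def Let_def)
  obtain es where es: "queue (push_children v i Q S st1) = queue st1 @ es" "length es = length S"
     "\<forall>e\<in>set es. \<exists>v' x. x \<in> set S \<and> e = (v', Suc i, List.insert x Q)"
     "length (tree (push_children v i Q S st1)) = length (tree st1) + length S"
     "meter (push_children v i Q S st1) =
       (if S = [] then meter st1
        else store (queue_words es + 2 * length S) (tick (length S * (3 * length Q + 1)) (meter st1)))"
    using Cons.IH[of st1] by blast
  show ?case
    unfolding st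
  proof (intro exI[of _ "e # es"] conjI)
    show "\<forall>e'\<in>set (e # es). \<exists>v' y. y \<in> set (x # S) \<and> e' = (v', Suc i, List.insert y Q)"
      using es(3) by (fastforce simp: e_def)
    show "meter (push_children v i Q S st1) =
      (if x # S = [] then meter st
       else store (queue_words (e # es) + 2 * length (x # S))
         (tick (length (x # S) * (3 * length Q + 1)) (meter st)))"
      using es(2) unfolding es(5)
      by (cases "S = []") (simp_all add: st1_def queue_words_def tick_store store_store add_ac)
  qed (simp_all only: es(1,4), simp_all add: es(2) st1_def)
qed


subsection \<open>The weight of a subtree\<close>

definition subtree_weight :: "nat \<Rightarrow> nat \<Rightarrow> (nat \<Rightarrow> nat) \<Rightarrow> nat \<Rightarrow> nat" where
  "subtree_weight s h f i = (\<Sum>j<Suc h - i. s ^ j * f (i + j))"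

lemma subtree_weight_top: "subtree_weight s h f h = f h"
  by (simp add: subtree_weight_def)

lemma subtree_weight_step:
  "i < h \<Longrightarrow> subtree_weight s h f i = f i + s * subtree_weight s h f (Suc i)"
  by (simp add: subtree_weight_def Suc_diff_le sum.lessThan_Suc_shift sum_distrib_left mult_ac
      del: sum.lessThan_Suc)

lemma subtree_weight_ge: "i \<le> h \<Longrightarrow> f i \<le> subtree_weight s h f i"
  by (cases "i = h") (auto simp: subtree_weight_top subtree_weight_step)

lemma subtree_weight_leaves:
  "i \<le> h \<Longrightarrow> subtree_weight s h (\<lambda>j. if j = h then 1 else 0) i = s ^ (h - i)"
proof (induction "h - i" arbitrary: i)
  case 0
  then show ?case by (simp add: subtree_weight_top)
next
  case (Suc k)
  then have "subtree_weight s h (\<lambda>j. if j = h then 1 else 0) (Suc i) = s ^ (h - Suc i)"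
    by simp
  moreover have "i < h"
    using Suc.hyps(2) by simp
  moreover from this have "s ^ (h - i) = s * s ^ (h - Suc i)"
    by (metis Suc_diff_Suc power_Suc)
  ultimately show ?case
    by (simp add: subtree_weight_step)
qed

definition potential :: "nat \<Rightarrow> nat \<Rightarrow> (nat \<Rightarrow> nat) \<Rightarrow> entry list \<Rightarrow> nat" where
  "potential s h f q = sum_list (map (\<lambda>(v, i, Q). subtree_weight s h f i) q)"

lemma potential_simps [simp]:
  "potential s h f [] = 0"
  "potential s h f ((v, i, Q) # q) = subtree_weight s h f i + potential s h f q"
  "potential s h f (q @ q') = potential s h f q + potential s h f q'"
  by (simp_all add: potential_def)

lemma potential_uniform:
  "\<forall>e\<in>set es. fst (snd e) = i \<Longrightarrow> potential s h f es = length es * subtree_weight s h f i"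
  by (induction es) auto

lemma potential_ge:
  assumes "\<forall>(v, i, Q)\<in>set q. g \<le> subtree_weight s h f i"
  shows "length q * g \<le> potential s h f q"
  using assms by (induction q) (auto simp: add_mono)

text \<open>Leaves and inner nodes are treated alike: a leaf has weight \<open>f h\<close> and no
  children, and otherwise \<open>subtree_weight_step\<close> splits the weight among the
  \<open>s\<close> children.\<close>

lemma potential_pop:
  assumes "i \<le> h" "length es = (if i < h then s else 0)" "\<forall>e\<in>set es. fst (snd e) = Suc i"
  shows "potential s h f ((v, i, Q) # q) = f i + potential s h f (q @ es)"
  using assms potential_uniform[OF assms(3), of s h f]
  by (cases "i = h") (auto simp: subtree_weight_top subtree_weight_step)


text \<open>The induction step amounts to 4 b^k \<le> 3 b^(k+1), which is the assumption on
  \<open>b\<close>; this ties the factor 4 to the threshold 4/3.\<close>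

lemma geometric_sum_le:
  fixes b :: real
  assumes "4 / 3 \<le> b"
  shows "(\<Sum>j<Suc k. b ^ j) \<le> 4 * b ^ k"
proof (induction k)
  case (Suc k)
  have "4 * b ^ k \<le> 3 * (b * b ^ k)"
    using mult_right_mono[of "4 / 3" b "b ^ k"] assms by simp
  then show ?case
    using Suc.IH by simp
qed simp


subsection \<open>Invariants of the construction\<close>

locale tree_construction =
  fixes L d n :: nat and I :: input and A :: implementation
  assumes valid_in: "valid_input d n I" and valid_impl: "valid_implementation L I A"
begin

abbreviation "s \<equiv> ssize A"
abbreviation "h \<equiv> hgt I"
abbreviation "leaves \<equiv> s ^ (h - 1)"
abbreviation "nodes \<equiv> subtree_weight s h (\<lambda>_. 1) 1"

definition rounds :: nat where
  "rounds = nat \<lceil>1 / (acc A)\<^sup>2\<rceil> - 1"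

text \<open>An upper bound that includes the 14 n paid in advance for creating the node. The factor
  \<open>min i n\<close> bounds the path length: the general time bound uses it through
  \<open>i\<close>, the bound for constant accuracy through \<open>n\<close>.\<close>

definition node_cost :: "nat \<Rightarrow> nat" where
  "node_cost i = (30 + L) * (n + min i n * rounds) * d"

text \<open>Only \<open>length Q \<le> i\<close> holds, because a point drawn again on its own path
  is not inserted twice. Distinctness yields the second bound \<open>n\<close>.\<close>

definition good_entry :: "entry \<Rightarrow> bool" where
  "good_entry = (\<lambda>(v, i, Q). 1 \<le> i \<and> i \<le> h \<and> Q \<noteq> [] \<and> distinct Q \<and> set Q \<subseteq> {..<n} \<and> length Q \<le> i)"

text \<open>The summands are: the input; \<open>h + 3\<close> words per queue entry and one more per
  leaf for the sample; the tree array; the center; distances and selected positions; the scratch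
  space of the selector; the popped entry, which is freed last.\<close>

definition space_bound :: nat where
  "space_bound = n * d + leaves * (h + 4) + 2 * nodes + d + 2 * n + L * n + h + 3"

definition footprint :: "state \<Rightarrow> nat" where
  "footprint st = n * d + queue_words (queue st) + 2 * length (tree st)"

text \<open>Nodes are charged for their own creation only when they are popped: the nodes still in the
  queue, at a cost of at most \<open>14 n\<close> each, have been paid in advance.\<close>
definition inv :: "state \<Rightarrow> bool" where
  "inv st \<longleftrightarrow>
     (\<forall>e\<in>set (queue st). good_entry e) \<and>
     potential s h (\<lambda>i. if i = h then 1 else 0) (queue st) \<le> leaves \<and>
     length (tree st) + potential s h (\<lambda>_. 1) (queue st) \<le> nodes + length (queue st) \<and>
     time (meter st) + potential s h node_cost (queue st)
       \<le> 7 + subtree_weight s h node_cost 1 + 14 * n * length (queue st)"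

definition space_inv :: "state \<Rightarrow> bool" where
  "space_inv st \<longleftrightarrow> used (meter st) \<le> footprint st \<and> peak (meter st) \<le> space_bound"

section \<open>Elementary facts about the parameters\<close>

lemma pos: "1 \<le> d" "1 \<le> n" "1 \<le> h"
  and len_points: "length (points I) = n"
  and len_point: "p \<in> set (points I) \<Longrightarrow> length p = d"
  using valid_in by (auto simp: valid_input_def)

lemma one_le_input_size: "1 \<le> real n * real d"
  using mult_mono[of 1 "real n" 1 "real d"] pos by simp

lemma start_in: "Q \<noteq> [] \<Longrightarrow> start A Q \<in> set Q"
  and selector: "linear_time_selector L (select A)"
  and acc_pos: "0 < acc A"
  using valid_impl by (auto simp: valid_implementation_def)

lemma num_far: "1 \<le> num_far I" "num_far I \<le> n"
proof -
  have "0 < (1 + del I) * gam I * real n"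
    using valid_in by (auto simp: valid_input_def)
  then show "1 \<le> num_far I"
    using pos len_points by (simp add: num_far_def Suc_le_eq)
qed (simp add: num_far_def len_points)

text \<open>Here 2/3 bounds ln 2 from below, and the other factor is at least 2 as
  \<open>del I < 1\<close>. For \<open>h = 1\<close> the logarithm is ln (1/mu), which can be
  arbitrarily small, so that case is treated separately later.\<close>

lemma sample_size_ge:
  assumes "2 \<le> h"
  shows "4 / 3 \<le> sample_size I"
proof -
  have v: "0 < del I" "del I < 1" "0 < mu I" "mu I < 1"
    using valid_in by (auto simp: valid_input_def)
  have "2 \<le> real h / mu I"
    using assms v by (simp add: le_divide_eq)
  then have "2 / 3 \<le> ln (real h / mu I)"
    using ln2_ge_two_thirds by (smt (verit) ln_le_cancel_iff)
  moreover have "2 \<le> 1 + 1 / del I"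
    using v by simp
  ultimately have "2 * (2 / 3) \<le> (1 + 1 / del I) * ln (real h / mu I)"
    by (intro mult_mono) auto
  then show ?thesis
    by (simp add: sample_size_def)
qed

lemma s_pos: "2 \<le> h \<Longrightarrow> 1 \<le> s"
  using sample_size_ge valid_impl unfolding valid_implementation_def
  by (auto simp: le_nat_iff le_floor_iff one_le_ceiling)

section \<open>Queue entries and the consequences of the invariant\<close>

lemma good_entry_bounds:
  assumes "good_entry (v, i, Q)"
  shows "length Q \<le> min i n" "length Q \<ge> 1" "entry_words (v, i, Q) \<le> h + 3"
    "\<forall>i\<in>set Q. length (points I ! i) = d"
proof -
  have "length Q \<le> n"
    using assms card_mono[of "{..<n}" "set Q"]
    by (auto simp: good_entry_def distinct_card)
  then show "length Q \<le> min i n"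
    using assms by (auto simp: good_entry_def)
qed (use assms len_points len_point in \<open>auto simp: good_entry_def Suc_le_eq\<close>)

lemma good_child:
  assumes "good_entry (v, i, Q)" "i < h" "x < n"
  shows "good_entry (v', Suc i, List.insert x Q)"
  using assms by (auto simp: good_entry_def List.insert_def)

lemma queue_words_le:
  assumes "\<forall>e\<in>set q. good_entry e"
  shows "queue_words q \<le> length q * (h + 3)"
proof -
  have "\<forall>e\<in>set q. entry_words e \<le> h + 3"
    using assms good_entry_bounds(3) by (metis prod_cases3)
  then show ?thesis
    using sum_list_mono[of q entry_words "\<lambda>_. h + 3"]
    by (simp add: queue_words_def sum_list_triv)
qed

text \<open>For \<open>h = 1\<close> the sample size may be 0, but the exponent is 0 as well and the
  power is 1; otherwise \<open>s_pos\<close> applies.\<close>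

lemma leaves_ge:
  assumes "good_entry (v, i, Q)"
  shows "1 \<le> s ^ (h - i)"
proof (cases "h = 1")
  case True
  then show ?thesis
    using assms by (simp add: good_entry_def)
next
  case False
  then show ?thesis
    using s_pos pos by simp
qed

text \<open>The subtrees of queued nodes each contribute at least one leaf to the leaf potential,
  which never exceeds the number of leaves of the whole tree. Hence the bound has no extra
  constant.\<close>

lemma queue_length_le:
  assumes "inv st"
  shows "length (queue st) \<le> leaves"
proof -
  have "length (queue st) * 1 \<le> potential s h (\<lambda>i. if i = h then 1 else 0) (queue st)"
  proof (rule potential_ge, clarify)
    fix v i Q
    assume "(v, i, Q) \<in> set (queue st)"
    then have "good_entry (v, i, Q)"
      using assms by (simp add: inv_def)
    then show "1 \<le> subtree_weight s h (\<lambda>i. if i = h then 1 else 0) i"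
      using leaves_ge by (subst subtree_weight_leaves) (auto simp: good_entry_def)
  qed
  then show ?thesis
    using assms by (simp add: inv_def)
qed

lemma potential_good_ge:
  assumes "inv st" "\<And>i. g \<le> f i"
  shows "length (queue st) * g \<le> potential s h f (queue st)"
proof (rule potential_ge, clarify)
  fix v i Q
  assume "(v, i, Q) \<in> set (queue st)"
  then have "i \<le> h"
    using assms(1) by (auto simp: inv_def good_entry_def)
  then show "g \<le> subtree_weight s h f i"
    using subtree_weight_ge[of i h f s] assms(2)[of i] by simp
qed

lemma tree_length_le: "inv st \<Longrightarrow> length (tree st) \<le> nodes"
  using potential_good_ge[of st 1 "\<lambda>_. 1"] by (simp add: inv_def)

text \<open>The advance of 14 n per queued node disappears, since the potential of that node is at
  least as large.\<close>

lemma time_le: "inv st \<Longrightarrow> time (meter st) \<le> 7 + subtree_weight s h node_cost 1"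
proof -
  assume "inv st"
  moreover have "14 * n * 1 \<le> node_cost i" for i
    unfolding node_cost_def using pos by (intro mult_mono) auto
  ultimately show ?thesis
    using potential_good_ge[of st "14 * n" node_cost] by (simp add: inv_def mult_ac)
qed

lemma queue_words_bound: "inv st \<Longrightarrow> queue_words (queue st) \<le> leaves * (h + 3)"
  by (rule order_trans[OF queue_words_le mult_right_mono[OF queue_length_le]]) (simp_all add: inv_def)

lemma footprint_le: "inv st \<Longrightarrow> footprint st \<le> n * d + leaves * (h + 3) + 2 * nodes"
  using queue_words_bound[of st] tree_length_le[of st] by (simp add: footprint_def)

section \<open>Preservation of the invariants\<close>

lemma inv_init:
  assumes "st \<in> set_pmf (init I)"
  shows "inv st \<and> space_inv st"
proof -
  have w: "sum_list (map length (points I)) = n * d"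
  proof -
    have "map length (points I) = map (\<lambda>_. d) (points I)"
      using len_point by (intro map_cong) auto
    then show ?thesis
      by (simp only: sum_list_triv len_points of_nat_id)
  qed
  \<comment> \<open>The 6 words are 4 for the root entry and 2 for its tree slot; with one unit for
    the random draw this gives the 7 in \<open>inv\<close>.\<close>
  obtain r where r: "r < n" and st: "st = \<lparr>queue = [(0, 1, [r])], tree = [(0, r)],
       meter = store 6 (tick 1 \<lparr>time = 0, used = n * d, peak = n * d\<rparr>)\<rparr>"
    using assms pos len_points w
    by (auto simp: init_def Let_def set_pmf_of_set lessThan_empty_iff)
  have "good_entry (0, 1, [r])"
    using r pos by (simp add: good_entry_def)
  moreover have "1 \<le> leaves"
    using leaves_ge[OF \<open>good_entry (0, 1, [r])\<close>] .
  then have "1 * (h + 4) \<le> leaves * (h + 4)"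
    by (rule mult_right_mono) simp
  then have "n * d + 6 \<le> space_bound"
    using pos by (simp add: space_bound_def)
  ultimately show ?thesis
    using subtree_weight_leaves[of 1 h s] pos
    by (simp add: inv_def space_inv_def footprint_def st store_def tick_def queue_words_def)
qed

text \<open>Outside the rounds, the terms free of \<open>s\<close> add up to at most (16 + L) n d;
  the 14 n for the creation of the popped node complete \<open>30 + L\<close>. The terms with
  \<open>s\<close> are at most 13 n s, covered by the advance for the children.\<close>

lemma grow_time_le:
  assumes "1 \<le> q" "q \<le> min i n" "k \<le> n" "t \<le> L * n" "w \<le> s * (n + 3)"
  shows "q + 4 + (1 + d + rounds * (q * (5 * d + 3) + 6 * d + 1)) + d + n * (5 * d + 1) + n
      + t + k + 3 * s + s * (3 * q + 1) + w + 2 * s + 14 * n \<le> node_cost i + 14 * n * s"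
proof -
  have a: "1 \<le> n * d" "d \<le> n * d" "n \<le> n * d"
    using pos by auto
  have b: "1 \<le> q * d" "d \<le> q * d" "q \<le> q * d"
    using pos assms(1) by auto
  have "q * (5 * d + 3) = 5 * (q * d) + 3 * q"
    by (simp add: algebra_simps)
  then have "q * (5 * d + 3) + 6 * d + 1 \<le> 15 * (q * d)"
    using b by linarith
  also have "\<dots> \<le> (30 + L) * (min i n * d)"
    using assms(2) by (intro mult_mono) auto
  finally have c: "rounds * (q * (5 * d + 3) + 6 * d + 1) \<le> rounds * ((30 + L) * (min i n * d))"
    by (rule mult_left_mono) simp
  have "q \<le> n"
    using assms(2) by simp
  then have e: "s * q \<le> s * n" "s * 1 \<le> s * n"
    using pos by (intro mult_left_mono; simp)+
  have l: "L * n \<le> L * (n * d)"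
    using a(3) by (rule mult_left_mono) simp
  have "node_cost i = 30 * (n * d) + L * (n * d) + rounds * ((30 + L) * (min i n * d))"
    "s * (3 * q + 1) = 3 * (s * q) + s" "s * (n + 3) = s * n + 3 * s"
    "n * (5 * d + 1) = 5 * (n * d) + n" "14 * n * s = 14 * (s * n)"
    by (simp_all add: node_cost_def algebra_simps)
  then show ?thesis
    using a c e l assms(3-5) \<open>q \<le> n\<close> by linarith
qed

text \<open>The bookkeeping common to leaves and inner nodes. The popped node gives back its
  advance, hence the 14 n beside the new time, and every child brings a new one.\<close>

lemma inv_pop:
  assumes "inv st" "queue st = (v, i, Q) # q"
    and es: "length es = (if i < h then s else 0)" "\<forall>e\<in>set es. good_entry e \<and> fst (snd e) = Suc i"
    and st': "queue st' = q @ es" "length (tree st') = length (tree st) + length es"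
    and time: "time (meter st') + 14 * n \<le> time (meter st) + node_cost i + 14 * n * length es"
  shows "inv st'"
proof -
  have "i \<le> h"
    using assms(1,2) by (auto simp: inv_def good_entry_def)
  then have pop: "potential s h f (queue st) = f i + potential s h f (queue st')" for f
    using potential_pop[of i h es s f v Q q] es assms(2) st' by simp
  have len: "length (queue st') + 1 = length (queue st) + length es"
    using assms(2) st' by simp
  \<comment> \<open>Multiplied out, the length equation speaks of the products that occur in
    \<open>inv\<close>, which linear arithmetic treats as atoms.\<close>
  have "14 * n * (length (queue st') + 1) = 14 * n * (length (queue st) + length es)"
    unfolding len ..
  then have "14 * n * length (queue st') + 14 * n = 14 * n * length (queue st) + 14 * n * length es"
    by (simp only: distrib_left mult_1_right)
  moreover have "\<forall>e\<in>set (queue st'). good_entry e"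
    using assms(1,2) es st' by (auto simp: inv_def)
  ultimately show ?thesis
    using assms(1) time st'(2) len pop[of "\<lambda>i. if i = h then 1 else 0"] pop[of "\<lambda>_. 1"] pop[of node_cost]
    unfolding inv_def by linarith
qed

lemma inv_leaf:
  assumes "inv st" "space_inv st" "queue st = (v, i, Q) # q" "\<not> i < h"
  defines "st' \<equiv> st\<lparr>queue := q,
    meter := free (entry_words (v, i, Q)) (tick (entry_words (v, i, Q) + 1) (meter st))\<rparr>"
  shows "inv st' \<and> space_inv st'"
proof
  have g: "good_entry (v, i, Q)"
    using assms by (simp add: inv_def)
  have "length Q + 4 + 14 * n \<le> 30 * n * 1"
    using good_entry_bounds[OF g] pos by simp
  also have "\<dots> \<le> node_cost i"
    unfolding node_cost_def using pos by (intro mult_mono) auto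
  finally show "inv st'"
    by (intro inv_pop[OF assms(1,3), of "[]"]) (use assms(4) in \<open>auto simp: st'_def free_def tick_def\<close>)
  show "space_inv st'"
    using assms by (auto simp: space_inv_def footprint_def free_def tick_def queue_words_def)
qed

text \<open>The meter \<open>m\<close> after sampling is spelled out in program order, so that
  \<open>inv_step\<close> only has to substitute the costs of the subroutines.\<close>

lemma inv_grow:
  assumes "inv st" "space_inv st" "queue st = (v, i, Q) # q" "i < h"
    and k: "k \<le> n" and t: "t \<le> L * n" and w: "w \<le> L * n"
    and S: "length S = s" "set S \<subseteq> {..<n}"
  defines "m \<equiv> store s (tick (2 * s) (store k (call t w (store n (tick (n * (5 * d + 1))
      (store d (tick (1 + d + rounds * (length Q * (5 * d + 3) + 6 * d + 1))
        (tick (entry_words (v, i, Q) + 1) (meter st)))))))))"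
  defines "st1 \<equiv> push_children v i Q S
    \<lparr>queue = q, tree = tree st, meter = free (d + n + k) m\<rparr>"
  defines "st' \<equiv> st1\<lparr>meter := free (s + entry_words (v, i, Q)) (meter st1)\<rparr>"
  shows "inv st' \<and> space_inv st'"
proof -
  have g: "good_entry (v, i, Q)"
    using assms by (simp add: inv_def)
  then have "2 \<le> h"
    using assms(4) by (simp add: good_entry_def)
  \<comment> \<open>Selects the nontrivial case of \<open>push_children_meter\<close>.\<close>
  then have "S \<noteq> []"
    using s_pos S(1) by auto
  obtain es where es: "queue st1 = q @ es" "length es = s"
     "\<forall>e\<in>set es. \<exists>v' x. x \<in> set S \<and> e = (v', Suc i, List.insert x Q)"
     "length (tree st1) = length (tree st) + s"
     "meter st1 = store (queue_words es + 2 * s) (tick (s * (3 * length Q + 1)) (free (d + n + k) m))"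
    using push_children_meter[of v i Q S "\<lparr>queue = q, tree = tree st, meter = free (d + n + k) m\<rparr>"]
      S(1) \<open>S \<noteq> []\<close> unfolding st1_def by auto
  have good: "\<forall>e\<in>set es. good_entry e \<and> fst (snd e) = Suc i"
    using es(3) S(2) good_child[OF g assms(4)] by fastforce
  \<comment> \<open>The bound by \<open>n\<close> instead of the height keeps the cost of each child
    within its advance of 14 n.\<close>
  have "entry_words e \<le> n + 3" if "e \<in> set es" for e
  proof -
    obtain v' i' Q' where e: "e = (v', i', Q')"
      by (cases e)
    then show ?thesis
      using good_entry_bounds(1)[of v' i' Q'] good that by simp
  qed
  then have qw: "queue_words es \<le> s * (n + 3)"
    using sum_list_mono[of es entry_words "\<lambda>_. n + 3"] es(2)
    by (simp add: queue_words_def sum_list_triv)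
  have st': "queue st' = q @ es" "length (tree st') = length (tree st) + length es"
    by (simp_all add: st'_def es)
  have "time (meter st') = time (meter st) + (length Q + 4
      + (1 + d + rounds * (length Q * (5 * d + 3) + 6 * d + 1)) + d + n * (5 * d + 1) + n
      + t + k + 3 * s + s * (3 * length Q + 1) + queue_words es + 2 * s)"
    by (simp add: st'_def es m_def tick_def store_def call_def free_def)
  then have time: "time (meter st') + 14 * n
      \<le> time (meter st) + node_cost i + 14 * n * length es"
    using add_left_mono[OF grow_time_le[OF good_entry_bounds(2,1)[OF g] k t qw], of "time (meter st)"]
    by (simp only: es(2) add.assoc)
  have inv': "inv st'"
    by (rule inv_pop[OF assms(1,3) _ good st' time]) (use es assms(4) in simp)
  \<comment> \<open>As \<open>h\<close> is at least 2, the sample fits into the one extra word per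
    leaf reserved in \<open>space_bound\<close>.\<close>
  have "s ^ 1 \<le> leaves"
    using s_pos \<open>2 \<le> h\<close> by (intro power_increasing) auto
  moreover have "leaves * (h + 4) = leaves * (h + 3) + leaves"
    by (simp add: algebra_simps)
  \<comment> \<open>Applied twice: to the old state for the scratch memory before the children
    exist, and to the new state for the moment when the popped entry and the sample are still
    allocated.\<close>
  ultimately have F: "footprint st'' + s + d + 2 * n + L * n + (h + 3) \<le> space_bound"
    if "inv st''" for st''
    using footprint_le[OF that] by (simp only: space_bound_def power_one_right)
  have u: "used (meter st) \<le> footprint st" "peak (meter st) \<le> space_bound"
    using assms(2) by (auto simp: space_inv_def)
  have um: "used m = used (meter st) + d + n + k + s"
    by (simp add: m_def tick_def store_def call_def)
  have "peak m \<le> max (peak (meter st)) (used (meter st) + d + n + k + s + w)"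
    by (simp add: m_def tick_def store_def call_def max_def)
  also have "\<dots> \<le> space_bound"
    using u F[OF assms(1)] k w by simp
  finally have pm: "peak m \<le> space_bound" .
  have fp: "footprint st' + entry_words (v, i, Q) = footprint st + queue_words es + 2 * s"
    using assms(3) es by (simp add: footprint_def st'_def queue_words_def)
  have us: "used (meter st1) = used (meter st) + s + queue_words es + 2 * s"
    by (simp add: es(5) store_def tick_def free_def um)
  have "peak (meter st1) = max (peak m) (used (meter st1))"
    by (simp add: es(5) store_def tick_def free_def)
  moreover have "used (meter st1) \<le> footprint st' + entry_words (v, i, Q) + s"
    using us fp u by simp
  ultimately have "peak (meter st1) \<le> space_bound" "used (meter st') \<le> footprint st'"
    using pm F[OF inv'] good_entry_bounds(3)[OF g] by (auto simp: st'_def free_def)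
  then have "space_inv st'"
    by (simp add: space_inv_def st'_def free_def)
  with inv' show ?thesis ..
qed

lemma inv_step:
  assumes "inv st" "space_inv st" "st' \<in> set_pmf (step I A st)"
  shows "inv st' \<and> space_inv st'"
proof (cases "queue st")
  case Nil
  then show ?thesis
    using assms by (simp add: step_def)
next
  case (Cons e q)
  obtain v i Q where e: "queue st = (v, i, Q) # q"
    using Cons by (cases e) auto
  show ?thesis
  proof (cases "i < h")
    case False
    then show ?thesis
      using inv_leaf[OF assms(1,2) e] assms(3) by (simp add: step_def e Let_def)
  next
    case True
    have g: "good_entry (v, i, Q)"
      using assms e by (simp add: inv_def)
    define m0 where "m0 = tick (entry_words (v, i, Q) + 1) (meter st)"
    obtain c m1 where c: "approx_center (start A) (points I) (acc A) Q m0 = (c, m1)"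
      by (cases "approx_center (start A) (points I) (acc A) Q m0")
    have m1: "length c = d"
      "m1 = store d (tick (1 + d + rounds * (length Q * (5 * d + 3) + 6 * d + 1)) m0)"
      using approx_center_meter[of Q "points I" d "start A" "acc A" m0] c g start_in[of Q]
        good_entry_bounds(4)[OF g] by (auto simp: good_entry_def rounds_def)
    obtain D m2 where D: "distances c (points I) m1 = (D, m2)"
      by (cases "distances c (points I) m1")
    have m2: "length D = n" "m2 = store n (tick (n * (5 * d + 1)) m1)"
      using distances_meter[of "points I" c m1] D m1 len_point len_points pos by auto
    obtain F t w where F: "select A (num_far I) D = (F, t, w)"
      by (cases "select A (num_far I) D")
    have F': "length F = num_far I" "set F \<subseteq> {..<n}" "t \<le> L * n" "w \<le> L * n"
      using selector num_far F m2 unfolding linear_time_selector_def by fastforce+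
    \<comment> \<open>The uniform draw needs a nonempty support; \<open>num_far\<close> is at least
      1.\<close>
    have "F \<noteq> []"
      using F' num_far by auto
    obtain S m3 where S: "(S, m3) \<in> set_pmf (draw s F (store (length F) (call t w m2)))"
      and st': "st' = (let st'' = push_children v i Q S \<lparr>queue = q, tree = tree st,
          meter = free (length c + length D + length F) m3\<rparr>
        in st''\<lparr>meter := free (length S + entry_words (v, i, Q)) (meter st'')\<rparr>)"
      using assms(3) True c D F unfolding m0_def step_def e by (auto simp: Let_def)
    have S': "length S = s" "set S \<subseteq> set F"
      "m3 = store s (tick (2 * s) (store (length F) (call t w m2)))"
      using draw_meter[OF S \<open>F \<noteq> []\<close>] s_pos g True by (auto simp: good_entry_def)
    show ?thesis
      using inv_grow[OF assms(1,2) e True num_far(2) F'(3,4) S'(1)] S'(2) F'(2)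
      unfolding st' Let_def S'(3,1) m2 m1 m0_def F'(1) by blast
  qed
qed

lemma inv_reachable:
  assumes "st \<in> reachable I A"
  shows "inv st" "space_inv st"
proof -
  have "inv st \<and> space_inv st" if "st \<in> set_pmf (run I A j)" for j st
    using that by (induction j arbitrary: st) (use inv_init inv_step in auto)
  then show "inv st" "space_inv st"
    using assms by (auto simp: reachable_def)
qed


subsection \<open>Bounds in terms of the branching factor\<close>

lemma branching_ge: "real s \<le> branching I A"
  by (simp add: branching_def)

lemma power_s_le: "real (s ^ j) \<le> branching I A ^ j"
  using branching_ge by (simp add: power_mono)

lemma leaves_le: "real leaves \<le> tree_const I A"
  unfolding tree_const_def by (rule power_s_le)

lemma tree_const_ge_1: "1 \<le> tree_const I A"
proof (cases "h = 1")
  case False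
  then have "1 \<le> leaves"
    using s_pos pos by simp
  then show ?thesis
    using leaves_le by linarith
qed (simp add: tree_const_def)

text \<open>For \<open>h = 1\<close> the branching factor may lie below 4/3, but then the sum is the
  single term 1.\<close>

lemma branching_sum_le: "(\<Sum>j<h. branching I A ^ j) \<le> 4 * tree_const I A"
proof (cases "h = 1")
  case False
  then have "4 / 3 \<le> branching I A"
    using sample_size_ge pos by (simp add: branching_def le_max_iff_disj)
  from geometric_sum_le[OF this, of "h - 1"] show ?thesis
    using pos by (simp add: tree_const_def del: sum.lessThan_Suc)
qed (simp add: tree_const_def)

lemma nodes_le: "real nodes \<le> 4 * tree_const I A"
proof -
  have "real nodes = (\<Sum>j<h. real (s ^ j))"
    by (simp add: subtree_weight_def)
  also have "\<dots> \<le> (\<Sum>j<h. branching I A ^ j)"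
    by (intro sum_mono power_s_le)
  finally show ?thesis
    using branching_sum_le by linarith
qed

text \<open>Rounding up N adds less than 1, and only N - 1 iterations are performed, so no additive
  constant remains.\<close>

lemma rounds_le: "real rounds \<le> 1 / (acc A)\<^sup>2"
proof -
  have "0 < 1 / (acc A)\<^sup>2"
    using acc_pos by simp
  then show ?thesis
    unfolding rounds_def by linarith
qed

lemma time_real_le:
  assumes "st \<in> reachable I A"
    and "\<And>j. real (node_cost (Suc j)) \<le> c j"
  shows "real (time (meter st)) \<le> 7 + (\<Sum>j<h. branching I A ^ j * c j)"
proof -
  have "time (meter st) \<le> 7 + (\<Sum>j<h. s ^ j * node_cost (Suc j))"
    using time_le[OF inv_reachable(1)[OF assms(1)]] by (simp add: subtree_weight_def)
  then have "real (time (meter st)) \<le> real (7 + (\<Sum>j<h. s ^ j * node_cost (Suc j)))"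
    by (rule of_nat_mono)
  also have "\<dots> = 7 + (\<Sum>j<h. real (s ^ j) * real (node_cost (Suc j)))"
    by simp
  also have "\<dots> \<le> 7 + (\<Sum>j<h. branching I A ^ j * c j)"
    using branching_ge assms(2)
    by (intro add_left_mono sum_mono mult_mono power_s_le zero_le_power) auto
  finally show ?thesis .
qed

section \<open>Running time\<close>

lemma running_time_le:
  "running_time I A \<le> ereal ((37 + real L) * (\<Sum>i=1..h.
      branching I A ^ (i - 1) * (real n + real i / (acc A)\<^sup>2) * real d))"
  unfolding running_time_def
proof (intro SUP_least ereal_less_eq(3)[THEN iffD2])
  fix st
  assume st: "st \<in> reachable I A"
  define c where "c j = (real n + real (Suc j) / (acc A)\<^sup>2) * real d" for j
  have c0: "0 \<le> c j" for j
    by (simp add: c_def)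
  have "real (node_cost (Suc j)) \<le> (30 + real L) * c j" for j
  proof -
    have "real (min (Suc j) n) * real rounds \<le> real (Suc j) * (1 / (acc A)\<^sup>2)"
      using rounds_le by (intro mult_mono) auto
    then have "(30 + real L) * ((real n + real (min (Suc j) n) * real rounds) * real d)
        \<le> (30 + real L) * c j"
      unfolding c_def by (intro mult_left_mono mult_right_mono) auto
    then show ?thesis
      by (simp only: node_cost_def of_nat_mult of_nat_add of_nat_numeral mult.assoc)
  qed
  from time_real_le[OF st this]
  have "real (time (meter st)) \<le> 7 + (30 + real L) * (\<Sum>j<h. branching I A ^ j * c j)"
    by (simp add: sum_distrib_left mult_ac)
  \<comment> \<open>The root term alone is at least n d, so the 7 units of initialization are
    absorbed: 37 = 30 + 7.\<close>
  moreover have "1 \<le> (\<Sum>j<h. branching I A ^ j * c j)"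
  proof -
    have "1 \<le> real (n * d)"
      using one_le_input_size by simp
    also have "\<dots> \<le> c 0"
      by (simp add: c_def distrib_right)
    also have "\<dots> = (\<Sum>j\<in>{0}. branching I A ^ j * c j)"
      by simp
    also have "\<dots> \<le> (\<Sum>j<h. branching I A ^ j * c j)"
      using pos c0 branching_ge by (intro sum_mono2) (auto intro!: mult_nonneg_nonneg zero_le_power)
    finally show ?thesis .
  qed
  ultimately have "real (time (meter st)) \<le> (37 + real L) * (\<Sum>j<h. branching I A ^ j * c j)"
    by (simp add: distrib_right)
  then show "real (time (meter st)) \<le> (37 + real L) *
      (\<Sum>i=1..h. branching I A ^ (i - 1) * (real n + real i / (acc A)\<^sup>2) * real d)"
    by (simp add: sum.atLeast1_atMost_eq c_def mult.assoc)
qed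

text \<open>Bounding path lengths by \<open>n\<close> instead of by the height makes the node cost
  O(n d) uniformly in the height; the geometric sum then gives C n d without a further factor
  \<open>h\<close>.\<close>

lemma running_time_le_const:
  assumes "1 / acc A \<le> E"
  shows "running_time I A \<le>
    ereal ((7 + 4 * (30 + real L) * (1 + E\<^sup>2)) * tree_const I A * real n * real d)"
  unfolding running_time_def
proof (intro SUP_least ereal_less_eq(3)[THEN iffD2])
  fix st
  assume st: "st \<in> reachable I A"
  define c where "c = (30 + real L) * (1 + E\<^sup>2) * real (n * d)"
  have "1 / (acc A)\<^sup>2 \<le> E\<^sup>2"
    using power_mono[OF assms, of 2] acc_pos by (simp add: power_one_over)
  then have r: "real rounds \<le> E\<^sup>2"
    using rounds_le by linarith
  have "real (node_cost (Suc j)) \<le> c" for j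
  proof -
    have "real (min (Suc j) n) * real rounds \<le> real n * E\<^sup>2"
      using r by (intro mult_mono) auto
    then have "(30 + real L) * ((real n + real (min (Suc j) n) * real rounds) * real d)
        \<le> (30 + real L) * ((real n + real n * E\<^sup>2) * real d)"
      by (intro mult_left_mono mult_right_mono) auto
    also have "\<dots> = c"
      by (simp add: c_def algebra_simps)
    finally show ?thesis
      by (simp only: node_cost_def of_nat_mult of_nat_add of_nat_numeral mult.assoc)
  qed
  from time_real_le[OF st this]
  have "real (time (meter st)) \<le> 7 + (\<Sum>j<h. branching I A ^ j) * c"
    by (simp add: sum_distrib_right)
  also have "\<dots> \<le> 7 * (tree_const I A * real (n * d)) + 4 * tree_const I A * c"
  proof (rule add_mono)
    have "1 * 1 \<le> tree_const I A * real (n * d)"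
      using tree_const_ge_1 one_le_input_size by (intro mult_mono) auto
    then show "7 \<le> 7 * (tree_const I A * real (n * d))"
      by simp
    show "(\<Sum>j<h. branching I A ^ j) * c \<le> 4 * tree_const I A * c"
      using branching_sum_le by (rule mult_right_mono) (simp add: c_def)
  qed
  also have "\<dots> = (7 + 4 * (30 + real L) * (1 + E\<^sup>2)) * tree_const I A * real n * real d"
    by (simp add: c_def algebra_simps)
  finally show "real (time (meter st)) \<le> \<dots>" .
qed

section \<open>Queue and total memory\<close>

lemma max_queue_size_le: "max_queue_size I A \<le> ereal (tree_const I A)"
  unfolding max_queue_size_def
proof (intro SUP_least ereal_less_eq(3)[THEN iffD2])
  fix st
  assume "st \<in> reachable I A"
  then have "length (queue st) \<le> leaves"
    by (intro queue_length_le inv_reachable)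
  then show "real (length (queue st)) \<le> tree_const I A"
    using leaves_le by linarith
qed

lemma leaves_mult_le: "real (leaves * (h + k)) \<le> (1 + real k) * (tree_const I A * real h)"
proof -
  have "real k * 1 \<le> real k * real h"
    using pos by (intro mult_left_mono) auto
  then have "real leaves * real (h + k) \<le> tree_const I A * ((1 + real k) * real h)"
    using leaves_le tree_const_ge_1 by (intro mult_mono) (auto simp: algebra_simps)
  then show ?thesis
    by (simp only: of_nat_mult mult_ac)
qed

lemma max_queue_space_le: "max_queue_space I A \<le> ereal (4 * tree_const I A * real h)"
  unfolding max_queue_space_def
proof (intro SUP_least ereal_less_eq(3)[THEN iffD2])
  fix st
  assume "st \<in> reachable I A"
  then have "queue_words (queue st) \<le> leaves * (h + 3)"
    by (intro queue_words_bound inv_reachable)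
  then have "real (queue_words (queue st)) \<le> real (leaves * (h + 3))"
    by (rule of_nat_mono)
  also have "\<dots> \<le> (1 + real 3) * (tree_const I A * real h)"
    by (rule leaves_mult_le)
  finally show "real (queue_words (queue st)) \<le> 4 * tree_const I A * real h"
    by simp
qed

lemma total_space_le:
  "total_space I A \<le> ereal ((17 + real L) * (tree_const I A * real h + real n * real d))"
  unfolding total_space_def
proof (intro SUP_least ereal_less_eq(3)[THEN iffD2])
  fix st
  assume "st \<in> reachable I A"
  then have "peak (meter st) \<le> space_bound"
    using inv_reachable(2) by (auto simp: space_inv_def)
  define w where "w = real (leaves * (h + 4))"
  have w: "w \<le> 5 * (tree_const I A * real h)"
    using leaves_mult_le[of 4] by (simp add: w_def)
  have "real (peak (meter st)) \<le> real space_bound"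
    using \<open>peak (meter st) \<le> space_bound\<close>
    by (rule of_nat_mono)
  also have "\<dots> = real n * real d + w + 2 * real nodes + real d + 2 * real n
      + real L * real n + real h + 3"
    unfolding space_bound_def w_def by (simp only: of_nat_add of_nat_mult of_nat_numeral)
  \<comment> \<open>With C for \<open>tree_const I A\<close>, the multiples of C h are 5 for
    \<open>w\<close>, 8 for the tree array, 1 for \<open>h\<close> and 3 for the constant. The
    multiples of n d are 1 for the input, 1 for the center, 2 for the two arrays and L for the
    selector.\<close>
  also have "\<dots> \<le> 17 * (tree_const I A * real h) + (4 + real L) * (real n * real d)"
  proof -
    have "tree_const I A * 1 \<le> tree_const I A * real h"
      using pos tree_const_ge_1 by (intro mult_left_mono) auto
    moreover have "1 * real h \<le> tree_const I A * real h"
      using tree_const_ge_1 by (rule mult_right_mono) simp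
    moreover have "1 * real d \<le> real n * real d" "real n * 1 \<le> real n * real d"
      using pos by (intro mult_right_mono mult_left_mono; simp)+
    moreover from this(2) have "real L * real n \<le> real L * (real n * real d)"
      by (intro mult_left_mono) auto
    moreover have "1 \<le> real h"
      using pos by simp
    moreover have "(4 + real L) * (real n * real d) = 4 * (real n * real d) + real L * (real n * real d)"
      by (rule distrib_right)
    ultimately show ?thesis
      using w nodes_le by linarith
  qed
  also have "\<dots> \<le> (17 + real L) * (tree_const I A * real h) + (17 + real L) * (real n * real d)"
    using tree_const_ge_1 by (intro add_mono mult_right_mono mult_nonneg_nonneg) auto
  finally show "real (peak (meter st)) \<le>
      (17 + real L) * (tree_const I A * real h + real n * real d)"
    by (simp only: distrib_left)
qed

end

section \<open>The complexity bounds with uniform constants\<close>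

theorem mainTheorem2:
  fixes L :: nat
  shows
    "(\<exists>K>0. \<forall>d n I A. valid_input d n I \<and> valid_implementation L I A \<longrightarrow>
        running_time I A \<le>
          ereal (K * (\<Sum>i=1..hgt I.
            branching I A ^ (i - 1) * (real n + real i / (acc A)\<^sup>2) * real d)))
     \<and> (\<forall>E. \<exists>K>0. \<forall>d n I A. valid_input d n I \<and> valid_implementation L I A \<and> 1 / acc A \<le> E \<longrightarrow>
        running_time I A \<le> ereal (K * tree_const I A * real n * real d))
     \<and> (\<forall>d n I A. valid_input d n I \<and> valid_implementation L I A \<longrightarrow>
        max_queue_size I A \<le> ereal (tree_const I A))
     \<and> (\<exists>K>0. \<forall>d n I A. valid_input d n I \<and> valid_implementation L I A \<longrightarrow>
        max_queue_space I A \<le> ereal (K * tree_const I A * real (hgt I)))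
     \<and> (\<exists>K>0. \<forall>d n I A. valid_input d n I \<and> valid_implementation L I A \<longrightarrow>
        total_space I A \<le> ereal (K * (tree_const I A * real (hgt I) + real n * real d)))"
proof -
  have loc: "tree_construction L d n I A" if "valid_input d n I \<and> valid_implementation L I A" for d n I A
    using that by (simp add: tree_construction_def)
  \<comment> \<open>The witnesses for the constants depend only on \<open>L\<close> and, for
    constant accuracy, on \<open>E\<close>.\<close>
  have K: "0 < 37 + real L" "0 < 7 + 4 * (30 + real L) * (1 + E\<^sup>2)" "0 < (4 :: real)" "0 < 17 + real L"
    for E :: real
    by (auto intro!: add_pos_nonneg)
  show ?thesis
    apply (intro conjI allI)
        apply (intro exI conjI allI impI, rule K(1), rule tree_construction.running_time_le[OF loc], blast)
       apply (intro exI conjI allI impI, rule K(2), rule tree_construction.running_time_le_const[OF loc])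
        apply (blast, blast)
      apply (rule impI, rule tree_construction.max_queue_size_le[OF loc], assumption)
     apply (intro exI conjI allI impI, rule K(3), rule tree_construction.max_queue_space_le[OF loc], assumption)
    apply (intro exI conjI allI impI, rule K(4), rule tree_construction.total_space_le[OF loc], assumption)
    done
qed

end
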